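(* Let $k\geq 1$ be an integer. For a $k$-strict partition $\pi$, let $\pi^2$ be the partition obtained as follows: for every part value $p$ occurring in $\pi$ with multiplicity $m_p$, $\pi^2$ contains $p$ with multiplicity $2\lfloor m_p/2\rfloor$; and let $\pi^1$ be the partition containing each part value $p$ of $\pi$ with multiplicity $m_p-2\lfloor m_p/2\rfloor$. Then the map $\psi_k:\pi\mapsto(\pi^1,\pi^2)$ is a bijection from $\mathcal{S}^k$ to $\mathcal{DS}^k\times\mathcal{E}^k$ such that $\ell(\pi)=\ell(\pi^1)+\ell(\pi^2)$ and $$\omega^k_{\pi}\big((a_i),(b_i)\big)=\omega^k_{\pi^1}\big((a_i),(b_i)\big)\,\omega^k_{\pi^2}\big((a_i),(b_i)\big).$$
   Context: A partition $\pi$ is $k$-strict if for every $m\in\mathbb{N}$ and all $1\le r_1\le r_2\le k-1$, the numbers $mk+r_1$ and $mk+r_2$ do not appear together as parts of $\pi$ (in particular, with $r_1=r_2$, parts not divisible by $k$ are not repeated); equivalently at most one part (counted with multiplicity) lies in each block $\{mk+1,\dots,mk+k-1\}$. $\mathcal{S}^k$ is the set of $k$-strict partitions; $\mathcal{D}$ is the set of partitions into distinct parts; $\mathcal{DS}^k=\mathcal{D}\cap\mathcal{S}^k$; $\mathcal{E}^k$ is the set of partitions all of whose parts are $\equiv 0\pmod k$ and each part occurs an even number of times. $\ell(\pi)$ is the number of parts. For commuting variables $a_1,\dots,a_k,b_1,\dots,b_k$, the weight $\omega^k_\pi((a_i),(b_i))$ is defined by labelling the cells of each odd-indexed row of the Ferrers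 diagram of $\pi$ (rows $\pi_1\ge\pi_2\ge\cdots$, top row indexed 1) from left to right cyclically by $a_1,a_2,\dots,a_k,a_1,\dots$, the cells of each even-indexed row cyclically by $b_1,\dots,b_k,b_1,\dots$, and taking the product of all labels. *)

theory Defs
  imports "HOL-Library.Multiset"
begin

text \<open>An integer partition is represented by the finite multiset of its (positive) parts;
  the number of parts of \<open>\<pi>\<close> is \<open>size \<pi>\<close>.\<close>

definition partitions :: "nat multiset set" where
  "partitions = {\<pi>. 0 \<notin># \<pi>}"

text \<open>Two parts appear together in \<open>\<pi>\<close> when the two-element multiset they form is contained
  in \<open>\<pi>\<close>; for \<open>r1 = r2\<close> this says that the part \<open>m * k + r1\<close> is repeated.  The block index
  \<open>m\<close> may be \<open>0\<close>.\<close>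

definition strict_partitions :: "nat \<Rightarrow> nat multiset set" where
  "strict_partitions k =
     {\<pi> \<in> partitions. \<forall>m r1 r2. 1 \<le> r1 \<and> r1 \<le> r2 \<and> r2 \<le> k - 1 \<longrightarrow>
        \<not> {#m * k + r1, m * k + r2#} \<subseteq># \<pi>}"

definition distinct_partitions :: "nat multiset set" where
  "distinct_partitions = {\<pi> \<in> partitions. \<forall>p. count \<pi> p \<le> 1}"

definition distinct_strict_partitions :: "nat \<Rightarrow> nat multiset set" where
  "distinct_strict_partitions k = distinct_partitions \<inter> strict_partitions k"

definition even_mult_partitions :: "nat \<Rightarrow> nat multiset set" where
  "even_mult_partitions k =
     {\<pi> \<in> partitions. \<forall>p \<in># \<pi>. p mod k = 0 \<and> even (count \<pi> p)}"

definition rows :: "nat multiset \<Rightarrow> nat list" where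
  "rows \<pi> = rev (sorted_list_of_multiset \<pi>)"

text \<open>Cells are pairs (row, column), both counted from 1; lists are indexed from 0.\<close>

definition ferrers :: "nat multiset \<Rightarrow> (nat \<times> nat) set" where
  "ferrers \<pi> = (SIGMA i:{1..size \<pi>}. {1..rows \<pi> ! (i - 1)})"

definition cell_label :: "nat \<Rightarrow> (nat \<Rightarrow> 'a) \<Rightarrow> (nat \<Rightarrow> 'a) \<Rightarrow> nat \<times> nat \<Rightarrow> 'a" where
  "cell_label k a b = (\<lambda>(i, j). (if odd i then a else b) ((j - 1) mod k + 1))"

text \<open>Only the values of \<open>a\<close> and \<open>b\<close> at \<open>1, \<dots>, k\<close> are used.  They range over an arbitrary
  commutative monoid, which covers the case of indeterminates: monomials in commuting variables
  form the free commutative monoid on those variables.\<close>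

definition weight ::
  "nat \<Rightarrow> (nat \<Rightarrow> 'a::comm_monoid_mult) \<Rightarrow> (nat \<Rightarrow> 'a) \<Rightarrow> nat multiset \<Rightarrow> 'a" where
  "weight k a b \<pi> = (\<Prod>c\<in>ferrers \<pi>. cell_label k a b c)"

definition paired_parts :: "nat multiset \<Rightarrow> nat multiset" where
  "paired_parts \<pi> = (\<Sum>p\<in>set_mset \<pi>. replicate_mset (2 * (count \<pi> p div 2)) p)"

definition unpaired_parts :: "nat multiset \<Rightarrow> nat multiset" where
  "unpaired_parts \<pi> =
     (\<Sum>p\<in>set_mset \<pi>. replicate_mset (count \<pi> p - 2 * (count \<pi> p div 2)) p)"

text \<open>The rule for the map does not depend on \<open>k\<close>; only its domain and codomain do.\<close>

definition psi :: "nat multiset \<Rightarrow> nat multiset \<times> nat multiset" where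
  "psi \<pi> = (unpaired_parts \<pi>, paired_parts \<pi>)"

lemma finite_ferrers: "finite (ferrers \<pi>)"
  by (simp add: ferrers_def)

lemma length_rows: "length (rows \<pi>) = size \<pi>"
  by (metis length_rev mset_sorted_list_of_multiset rows_def size_mset)

lemma count_sum_replicate_mset:
  "count (\<Sum>p\<in>set_mset \<pi>. replicate_mset (f p) p) q = (if q \<in># \<pi> then f q else 0)"
  by (simp add: count_sum)

lemma count_paired_parts: "count (paired_parts \<pi>) p = 2 * (count \<pi> p div 2)"
  by (simp add: paired_parts_def count_sum_replicate_mset not_in_iff)

lemma count_unpaired_parts:
  "count (unpaired_parts \<pi>) p = count \<pi> p - 2 * (count \<pi> p div 2)"
  by (simp add: unpaired_parts_def count_sum_replicate_mset not_in_iff)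

end

theory Submission
  imports Defs
begin

text \<open>Two equal parts \<open>p, p\<close> of a partition fill two consecutive rows, one of each parity, and
  removing them does not change the parity of any other row.  So such a pair contributes the same
  factor to the weight whatever the remaining parts are, and the weight is multiplicative when a
  partition with even multiplicities is added.  The inverse of \<open>\<psi>\<^sub>k\<close> is addition of multisets: a
  repeated part of a \<open>k\<close>-strict partition is a multiple of \<open>k\<close>, and multiples of \<open>k\<close> are
  irrelevant for \<open>k\<close>-strictness.\<close>

text \<open>Swapping \<open>f\<close> and \<open>g\<close> in the recursive call encodes row parity
  without indices, so entries can be inserted in mid-list by plain induction.\<close>

fun alternating_prod :: "('b \<Rightarrow> 'a::comm_monoid_mult) \<Rightarrow> ('b \<Rightarrow> 'a) \<Rightarrow> 'b list \<Rightarrow> 'a" where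
  "alternating_prod f g [] = 1"
| "alternating_prod f g (x # xs) = f x * alternating_prod g f xs"

text \<open>Each entry of \<open>xs\<close> swaps \<open>f\<close> and \<open>g\<close>, but the
  factor \<open>f x * g x\<close> is symmetric in them. The two copies of \<open>x\<close> swap them
  twice, so \<open>ys\<close> is read as before.\<close>

lemma alternating_prod_insert_pair:
  "alternating_prod f g (xs @ x # x # ys) = alternating_prod f g (xs @ ys) * (f x * g x)"
  by (induction xs arbitrary: f g) (simp_all add: ac_simps)

lemma alternating_prod_eq_prod:
  "alternating_prod f g xs = (\<Prod>i<length xs. (if even i then f else g) (xs ! i))"
proof (induction xs arbitrary: f g)
  case (Cons x xs)
  \<comment> \<open>Matches the induction hypothesis for swapped functions with the tail of the
    product, where the shift by one turns \<open>even (Suc i)\<close> into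
    \<open>odd i\<close>.\<close>
  have "(\<Prod>i<length xs. (if even i then g else f) (xs ! i)) =
        (\<Prod>i<length xs. (if odd i then f else g) (xs ! i))"
    by (rule prod.cong) auto
  then show ?case
    by (simp add: Cons prod.lessThan_Suc_shift del: prod.lessThan_Suc)
qed simp

definition row_weight :: "nat \<Rightarrow> (nat \<Rightarrow> 'a::comm_monoid_mult) \<Rightarrow> nat \<Rightarrow> 'a" where
  "row_weight k a n = (\<Prod>j=1..n. a ((j - 1) mod k + 1))"

lemma weight_eq_alternating_prod:
  "weight k a b \<pi> = alternating_prod (row_weight k a) (row_weight k b) (rows \<pi>)"
proof -
  have "weight k a b \<pi> =
      (\<Prod>i=1..size \<pi>. \<Prod>j=1..rows \<pi> ! (i - 1). cell_label k a b (i, j))"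
    unfolding weight_def ferrers_def by (subst prod.Sigma) (auto simp: split_def)
  also have "\<dots> = (\<Prod>i=1..size \<pi>. row_weight k (if odd i then a else b) (rows \<pi> ! (i - 1)))"
    by (simp add: cell_label_def row_weight_def)
  \<comment> \<open>Rows count from 1 and list entries from 0, so odd rows sit at even
    indices.\<close>
  also have "\<dots> = (\<Prod>i<size \<pi>. row_weight k (if even i then a else b) (rows \<pi> ! i))"
    by (rule prod.reindex_bij_witness[of _ Suc "\<lambda>i. i - 1"]) auto
  also have "\<dots> = alternating_prod (row_weight k a) (row_weight k b) (rows \<pi>)"
    unfolding alternating_prod_eq_prod length_rows by (rule prod.cong) auto
  finally show ?thesis .
qed

text \<open>The second insertion passes the same entries as the first and stops at the first copy
  because \<open>x \<le> x\<close>; hence the copies are adjacent.\<close>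

lemma insort_twice_split:
  "\<exists>ys zs. xs = ys @ zs \<and> insort x (insort x xs) = ys @ x # x # zs"
proof (induction xs)
  case (Cons y xs)
  then obtain ys zs where *: "xs = ys @ zs" "insort x (insort x xs) = ys @ x # x # zs"
    by blast
  show ?case
  proof (cases "x \<le> y")
    case True
    then show ?thesis by (intro exI[of _ "[]"] exI[of _ "y # xs"]) auto
  next
    case False
    with * show ?thesis by (intro exI[of _ "y # ys"] exI[of _ zs]) auto
  qed
qed simp

lemma weight_add_pair:
  "weight k a b (add_mset p (add_mset p \<pi>)) =
     weight k a b \<pi> * (row_weight k a p * row_weight k b p)"
proof -
  obtain ys zs where "sorted_list_of_multiset \<pi> = ys @ zs"
    "insort p (insort p (sorted_list_of_multiset \<pi>)) = ys @ p # p # zs"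
    using insort_twice_split by blast
  then have "rows \<pi> = rev zs @ rev ys"
    "rows (add_mset p (add_mset p \<pi>)) = rev zs @ p # p # rev ys"
    by (simp_all add: rows_def)
  then show ?thesis
    by (simp add: weight_eq_alternating_prod alternating_prod_insert_pair)
qed

lemma weight_empty: "weight k a b {#} = 1"
  by (simp add: weight_def ferrers_def)

text \<open>Reduces even multiplicities to one pair at a time: a positive even count is at least 2,
  and splitting off two copies keeps every count even.\<close>

lemma even_count_multiset_induct [consumes 1, case_names empty add]:
  assumes "\<And>x. even (count M x)"
    and "P {#}"
    and "\<And>x N. (\<And>y. even (count N y)) \<Longrightarrow> P N \<Longrightarrow> P (add_mset x (add_mset x N))"
  shows "P M"
  using assms(1)
proof (induction M rule: measure_induct_rule[of size])
  case (less M)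
  show ?case
  proof (cases "M = {#}")
    case False
    then obtain x where "x \<in># M" by blast
    then have "count M x > 0" "even (count M x)"
      using less.prems by auto
    then have "count M x \<ge> 2" by presburger
    then have "{#x, x#} \<subseteq># M"
      by (auto simp: subseteq_mset_def)
    then obtain N where M: "M = add_mset x (add_mset x N)"
      by (auto simp: mset_subset_eq_exists_conv)
    have "even (count N y)" for y
      using less.prems[of y] by (simp add: M split: if_splits)
    then show ?thesis
      using less.IH[of N] assms(3) by (simp add: M)
  qed (simp add: assms(2))
qed

text \<open>Only \<open>\<sigma>\<close> is built up by pairs; by \<open>weight_add_pair\<close>
  each pair brings the same factor over \<open>\<pi> + N\<close> as over \<open>N\<close>.\<close>

lemma weight_add_even_mult:
  assumes "\<And>p. even (count \<sigma> p)"
  shows "weight k a b (\<pi> + \<sigma>) = weight k a b \<pi> * weight k a b \<sigma>"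
  using assms
  by (induction \<sigma> rule: even_count_multiset_induct)
    (simp_all add: weight_empty weight_add_pair ac_simps)

lemma unpaired_plus_paired: "unpaired_parts \<pi> + paired_parts \<pi> = \<pi>"
  by (rule multiset_eqI) (simp add: count_unpaired_parts count_paired_parts)

text \<open>Adding 0 or 1 to an even count and rounding down to an even number recovers that count;
  the remainder is the count in \<open>\<pi>\<close>.\<close>

lemma psi_add:
  assumes "\<pi> \<in> distinct_partitions" "\<sigma> \<in> even_mult_partitions k"
  shows "psi (\<pi> + \<sigma>) = (\<pi>, \<sigma>)"
proof -
  have "2 * (count (\<pi> + \<sigma>) p div 2) = count \<sigma> p" for p
  proof -
    have "count \<pi> p \<le> 1"
      using assms(1) by (simp add: distinct_partitions_def)
    moreover have "even (count \<sigma> p)"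
      \<comment> \<open>The definition constrains only parts that occur; elsewhere the count is 0,
        hence even.\<close>
      using assms(2) by (cases "p \<in># \<sigma>") (auto simp: even_mult_partitions_def not_in_iff)
    ultimately show ?thesis by simp presburger
  qed
  then show ?thesis
    unfolding psi_def prod.inject
    by (auto intro!: multiset_eqI simp only: count_unpaired_parts count_paired_parts) simp
qed

text \<open>Membership only forbids certain submultisets, including the part 0, so it passes to
  smaller multisets.\<close>

lemma strict_partitions_subset_mset:
  assumes "\<sigma> \<subseteq># \<pi>" "\<pi> \<in> strict_partitions k"
  shows "\<sigma> \<in> strict_partitions k"
  using assms mset_subset_eqD[OF assms(1)] subset_mset.order_trans[OF _ assms(1)]
  unfolding strict_partitions_def partitions_def by blast

lemma unpaired_parts_in_distinct_strict:
  assumes "\<pi> \<in> strict_partitions k"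
  shows "unpaired_parts \<pi> \<in> distinct_strict_partitions k"
proof -
  have "unpaired_parts \<pi> \<subseteq># \<pi>"
    by (metis unpaired_plus_paired mset_subset_eq_add_left)
  then have "unpaired_parts \<pi> \<in> strict_partitions k"
    using assms by (rule strict_partitions_subset_mset)
  moreover have "n - 2 * (n div 2) \<le> 1" for n :: nat
    by presburger
  ultimately show ?thesis
    by (simp add: distinct_strict_partitions_def distinct_partitions_def count_unpaired_parts
        strict_partitions_def)
qed

lemma strict_partitions_repeated_part_dvd:
  assumes "k \<ge> 1" "\<pi> \<in> strict_partitions k" "count \<pi> p \<ge> 2"
  shows "p mod k = 0"
proof (rule ccontr)
  assume "p mod k \<noteq> 0"
  moreover have "p mod k \<le> k - 1"
    using assms(1) mod_less_divisor[of k p] by linarith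
  moreover have "{#p, p#} \<subseteq># \<pi>"
    using assms(3) by (auto simp: subseteq_mset_def)
  \<comment> \<open>This is the forbidden pair with \<open>m = p div k\<close> and
    \<open>r1 = r2 = p mod k\<close>.\<close>
  then have "{#p div k * k + p mod k, p div k * k + p mod k#} \<subseteq># \<pi>"
    by simp
  ultimately show False
    using assms(2) unfolding strict_partitions_def
    by (metis (mono_tags, lifting) One_nat_def Suc_leI le_refl mem_Collect_eq neq0_conv)
qed

lemma paired_parts_in_even_mult:
  assumes "k \<ge> 1" "\<pi> \<in> strict_partitions k"
  shows "paired_parts \<pi> \<in> even_mult_partitions k"
proof -
  have "paired_parts \<pi> \<subseteq># \<pi>"
    by (metis unpaired_plus_paired mset_subset_eq_add_right)
  then have "paired_parts \<pi> \<in> partitions"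
    using strict_partitions_subset_mset[OF _ assms(2)] by (simp add: strict_partitions_def)
  moreover have "p mod k = 0" if "p \<in># paired_parts \<pi>" for p
  proof (rule strict_partitions_repeated_part_dvd[OF assms])
    have "count (paired_parts \<pi>) p > 0"
      using that by simp
    then show "count \<pi> p \<ge> 2"
      by (simp add: count_paired_parts del: count_greater_zero_iff)
  qed
  ultimately show ?thesis
    by (simp add: even_mult_partitions_def count_paired_parts)
qed

lemma strict_partitions_add_even_mult:
  assumes "\<pi> \<in> strict_partitions k" "\<sigma> \<in> even_mult_partitions k"
  shows "\<pi> + \<sigma> \<in> strict_partitions k"
proof -
  have "\<not> {#m * k + r1, m * k + r2#} \<subseteq># \<pi> + \<sigma>"
    if r: "1 \<le> r1" "r1 \<le> r2" "r2 \<le> k - 1" for m r1 r2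
  proof
    assume sub: "{#m * k + r1, m * k + r2#} \<subseteq># \<pi> + \<sigma>"
    have "(m * k + r1) mod k \<noteq> 0" "(m * k + r2) mod k \<noteq> 0"
      using r by auto
    then have "m * k + r1 \<notin># \<sigma>" "m * k + r2 \<notin># \<sigma>"
      using assms(2) by (auto simp: even_mult_partitions_def)
    \<comment> \<open>Being disjoint from \<open>\<sigma>\<close>, the pair is unchanged when
      \<open>\<sigma>\<close> is subtracted, so it lies entirely in \<open>\<pi>\<close>.\<close>
    then have "{#m * k + r1, m * k + r2#} \<inter># \<sigma> = {#}"
      by (simp add: inter_add_right1)
    then have "{#m * k + r1, m * k + r2#} \<subseteq># \<pi>"
      using sub by (metis subset_eq_diff_conv diff_intersect_left_idem Multiset.diff_empty)
    then show False
      using assms(1) r by (auto simp: strict_partitions_def)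
  qed
  then show ?thesis
    using assms
    by (simp add: strict_partitions_def even_mult_partitions_def partitions_def)
qed

theorem theorem2p3:
  fixes k :: nat and a b :: "nat \<Rightarrow> 'a::comm_monoid_mult"
  assumes "k \<ge> 1"
  shows "bij_betw psi (strict_partitions k)
           (distinct_strict_partitions k \<times> even_mult_partitions k) \<and>
         (\<forall>\<pi> \<in> strict_partitions k. \<forall>\<pi>1 \<pi>2. psi \<pi> = (\<pi>1, \<pi>2) \<longrightarrow>
            size \<pi> = size \<pi>1 + size \<pi>2 \<and>
            weight k a b \<pi> = weight k a b \<pi>1 * weight k a b \<pi>2)"
proof (intro conjI ballI allI impI)
  show "bij_betw psi (strict_partitions k)
          (distinct_strict_partitions k \<times> even_mult_partitions k)"
  proof (rule bij_betw_byWitness[where f' = "\<lambda>(\<pi>, \<sigma>). \<pi> + \<sigma>"])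
    show "\<forall>\<pi>\<in>strict_partitions k. (case psi \<pi> of (\<pi>, \<sigma>) \<Rightarrow> \<pi> + \<sigma>) = \<pi>"
      by (simp add: psi_def unpaired_plus_paired)
    show "\<forall>x\<in>distinct_strict_partitions k \<times> even_mult_partitions k.
        psi (case x of (\<pi>, \<sigma>) \<Rightarrow> \<pi> + \<sigma>) = x"
      by (auto simp: distinct_strict_partitions_def psi_add)
    show "psi ` strict_partitions k \<subseteq> distinct_strict_partitions k \<times> even_mult_partitions k"
      using assms
      by (auto simp: psi_def unpaired_parts_in_distinct_strict paired_parts_in_even_mult)
    show "(\<lambda>(\<pi>, \<sigma>). \<pi> + \<sigma>) ` (distinct_strict_partitions k \<times> even_mult_partitions k)
        \<subseteq> strict_partitions k"
      by (auto simp: distinct_strict_partitions_def strict_partitions_add_even_mult)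
  qed
next
  fix \<pi> \<pi>1 \<pi>2
  assume "psi \<pi> = (\<pi>1, \<pi>2)"
  then have parts: "\<pi>1 = unpaired_parts \<pi>" "\<pi>2 = paired_parts \<pi>"
    by (simp_all add: psi_def)
  \<comment> \<open>Both claims are additivity over this sum; for the weight it rests on the even
    multiplicities of \<open>\<pi>2\<close>.\<close>
  then have \<pi>: "\<pi> = \<pi>1 + \<pi>2"
    by (simp add: unpaired_plus_paired)
  then show "size \<pi> = size \<pi>1 + size \<pi>2"
    by (metis size_union)
  have "even (count \<pi>2 p)" for p
    by (simp add: parts count_paired_parts)
  then show "weight k a b \<pi> = weight k a b \<pi>1 * weight k a b \<pi>2"
    unfolding \<pi> by (rule weight_add_even_mult)
qed

end
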